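(* Let $s\colon S\rightarrowtail I$ be an idempotent subunit in a monoidal category $\mathbf{C}$. The restriction functor $\mathbf{C}\to\mathbf{C}|_s$, given by $E\mapsto E\otimes S$ and $f\mapsto f\otimes\mathrm{id}_S$, is a localisation of $\mathbf{C}$ at $\Sigma=\{\mathrm{id}_E\otimes s\mid E\in\mathbf{C}\}$.
   Context: A subunit in a monoidal category with tensor unit $I$ is a subobject of $I$, i.e. an equivalence class of monomorphisms $s\colon S\rightarrowtail I$, where two monomorphisms are identified if they factor through each other. A subunit $s\colon S\rightarrowtail I$ is idempotent when $s\otimes\mathrm{id}_S\colon S\otimes S\to I\otimes S$ is an isomorphism. For an idempotent subunit $s$, $\mathbf{C}|_s$ is the full subcategory of $\mathbf{C}$ of objects $E$ for which $\mathrm{id}_E\otimes s\colon E\otimes S\to E\otimes I$ is an isomorphism. Let $\mathbf{C}$ be a category and $\Sigma$ a collection of morphisms in $\mathbf{C}$. A localisation of $\mathbf{C}$ at $\Sigma$ is a category $\mathbf{C}[\Sigma^{-1}]$ together with a functor $Q\colon\mathbf{C}\to\mathbf{C}[\Sigma^{-1}]$ such that: (1) $Q(f)$ is an isomorphism for every $f\in\Sigma$; (2) for any functor $R\colon\mathbf{C}\to\mathbf{D}$ such that $R(f)$ is an isomorphism for all $f\in\Sigma$, there exist a functor $\overline{R}\colon\mathbf{C}[\Sigma^{-1}]\to\mathbf{D}$ and a natural isomorphism $\overline{R}\circ Q\simeq R$; (3) precomposition $(-)\circ Q\colon[\mathbf{C}[\Sigma^{-1}],\mathbf{D}]\to[\mathbf{C},\mathbf{D}]$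 is full and faithful for every category $\mathbf{D}$. *)

theory Defs
  imports "HOL-Library.FuncSet"
begin

section \<open>Categories\<close>

text \<open>The fields are only constrained on the carriers \<open>Obj\<close> and \<open>Arr\<close>.
  Composition is written in the usual order: \<open>g \<cdot> f\<close> is \<open>f\<close> followed by \<open>g\<close>.\<close>

record ('o, 'm) category =
  Obj :: "'o set"
  Arr :: "'m set"
  Dom :: "'m \<Rightarrow> 'o"
  Cod :: "'m \<Rightarrow> 'o"
  Ident :: "'o \<Rightarrow> 'm"
  Comp :: "'m \<Rightarrow> 'm \<Rightarrow> 'm" (infixl "\<cdot>\<index>" 60)

definition hom :: "('o, 'm, 'x) category_scheme \<Rightarrow> 'o \<Rightarrow> 'o \<Rightarrow> 'm set" where
  "hom C a b = {f \<in> Arr C. Dom C f = a \<and> Cod C f = b}"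

locale category =
  fixes C :: "('o, 'm, 'x) category_scheme" (structure)
  assumes Dom_in_Obj: "f \<in> Arr C \<Longrightarrow> Dom C f \<in> Obj C"
    and Cod_in_Obj: "f \<in> Arr C \<Longrightarrow> Cod C f \<in> Obj C"
    and Ident_in_hom: "a \<in> Obj C \<Longrightarrow> Ident C a \<in> hom C a a"
    and Comp_in_hom: "\<lbrakk>f \<in> hom C a b; g \<in> hom C b c\<rbrakk> \<Longrightarrow> g \<cdot> f \<in> hom C a c"
    and Comp_Ident: "f \<in> hom C a b \<Longrightarrow> f \<cdot> Ident C a = f"
    and Ident_Comp: "f \<in> hom C a b \<Longrightarrow> Ident C b \<cdot> f = f"
    and Comp_assoc: "\<lbrakk>f \<in> hom C a b; g \<in> hom C b c; h \<in> hom C c d\<rbrakk>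
      \<Longrightarrow> (h \<cdot> g) \<cdot> f = h \<cdot> (g \<cdot> f)"

definition is_iso :: "('o, 'm, 'x) category_scheme \<Rightarrow> 'm \<Rightarrow> bool" where
  "is_iso C f \<longleftrightarrow> f \<in> Arr C \<and>
    (\<exists>g \<in> hom C (Cod C f) (Dom C f).
      g \<cdot>\<^bsub>C\<^esub> f = Ident C (Dom C f) \<and> f \<cdot>\<^bsub>C\<^esub> g = Ident C (Cod C f))"

definition is_mono :: "('o, 'm, 'x) category_scheme \<Rightarrow> 'm \<Rightarrow> bool" where
  "is_mono C f \<longleftrightarrow> f \<in> Arr C \<and>
    (\<forall>a \<in> Obj C. \<forall>g \<in> hom C a (Dom C f). \<forall>h \<in> hom C a (Dom C f).
      f \<cdot>\<^bsub>C\<^esub> g = f \<cdot>\<^bsub>C\<^esub> h \<longrightarrow> g = h)"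

definition full_subcategory ::
  "('o, 'm, 'x) category_scheme \<Rightarrow> 'o set \<Rightarrow> ('o, 'm) category" where
  "full_subcategory C A =
    \<lparr>Obj = Obj C \<inter> A, Arr = {f \<in> Arr C. Dom C f \<in> A \<and> Cod C f \<in> A},
     Dom = Dom C, Cod = Cod C, Ident = Ident C, Comp = Comp C\<rparr>"


section \<open>Functors and natural transformations\<close>

text \<open>Functors and natural transformations are required to be extensional, i.e. to take the
  value \<open>undefined\<close> off the carriers. Hence HOL equality of functors, and of natural
  transformations, is the usual equality, and functor categories can be formed.\<close>

record ('o, 'm, 'p, 'n) cat_functor =
  FObj :: "'o \<Rightarrow> 'p"
  FArr :: "'m \<Rightarrow> 'n"

locale is_functor = source: category C + target: category D
  for C :: "('o, 'm, 'x) category_scheme" and D :: "('p, 'n, 'y) category_scheme" +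
  fixes F :: "('o, 'm, 'p, 'n) cat_functor"
  assumes FObj_extensional: "FObj F \<in> extensional (Obj C)"
    and FArr_extensional: "FArr F \<in> extensional (Arr C)"
    and FObj_in_Obj: "a \<in> Obj C \<Longrightarrow> FObj F a \<in> Obj D"
    and FArr_in_hom: "f \<in> hom C a b \<Longrightarrow> FArr F f \<in> hom D (FObj F a) (FObj F b)"
    and FArr_Ident: "a \<in> Obj C \<Longrightarrow> FArr F (Ident C a) = Ident D (FObj F a)"
    and FArr_Comp: "\<lbrakk>f \<in> hom C a b; g \<in> hom C b c\<rbrakk>
      \<Longrightarrow> FArr F (g \<cdot>\<^bsub>C\<^esub> f) = FArr F g \<cdot>\<^bsub>D\<^esub> FArr F f"

definition functor_comp ::
  "('o, 'm, 'x) category_scheme \<Rightarrow> ('p, 'n, 'q, 'k) cat_functor \<Rightarrow>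
   ('o, 'm, 'p, 'n) cat_functor \<Rightarrow> ('o, 'm, 'q, 'k) cat_functor" where
  "functor_comp C G F =
    \<lparr>FObj = compose (Obj C) (FObj G) (FObj F), FArr = compose (Arr C) (FArr G) (FArr F)\<rparr>"

locale nat_trans = source_functor: is_functor C D F + target_functor: is_functor C D G
  for C :: "('o, 'm, 'x) category_scheme" and D :: "('p, 'n, 'y) category_scheme"
    and F G :: "('o, 'm, 'p, 'n) cat_functor" +
  fixes \<eta> :: "'o \<Rightarrow> 'n"
  assumes component_extensional: "\<eta> \<in> extensional (Obj C)"
    and component_in_hom: "a \<in> Obj C \<Longrightarrow> \<eta> a \<in> hom D (FObj F a) (FObj G a)"
    and naturality: "f \<in> hom C a b \<Longrightarrow> \<eta> b \<cdot>\<^bsub>D\<^esub> FArr F f = FArr G f \<cdot>\<^bsub>D\<^esub> \<eta> a"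

definition naturally_isomorphic ::
  "('o, 'm, 'x) category_scheme \<Rightarrow> ('p, 'n, 'y) category_scheme \<Rightarrow>
   ('o, 'm, 'p, 'n) cat_functor \<Rightarrow> ('o, 'm, 'p, 'n) cat_functor \<Rightarrow> bool" where
  "naturally_isomorphic C D F G \<longleftrightarrow>
    (\<exists>\<eta>. nat_trans C D F G \<eta> \<and> (\<forall>a \<in> Obj C. is_iso D (\<eta> a)))"

definition full_functor ::
  "('o, 'm, 'x) category_scheme \<Rightarrow> ('p, 'n, 'y) category_scheme \<Rightarrow>
   ('o, 'm, 'p, 'n) cat_functor \<Rightarrow> bool" where
  "full_functor C D F \<longleftrightarrow> is_functor C D F \<and>
    (\<forall>a \<in> Obj C. \<forall>b \<in> Obj C. FArr F ` hom C a b = hom D (FObj F a) (FObj F b))"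

definition faithful_functor ::
  "('o, 'm, 'x) category_scheme \<Rightarrow> ('p, 'n, 'y) category_scheme \<Rightarrow>
   ('o, 'm, 'p, 'n) cat_functor \<Rightarrow> bool" where
  "faithful_functor C D F \<longleftrightarrow> is_functor C D F \<and>
    (\<forall>a \<in> Obj C. \<forall>b \<in> Obj C. inj_on (FArr F) (hom C a b))"

text \<open>A morphism of the functor category is a natural transformation tagged with its source and
  target functors.\<close>

type_synonym ('o, 'm, 'p, 'n) transformation =
  "('o, 'm, 'p, 'n) cat_functor \<times> ('o, 'm, 'p, 'n) cat_functor \<times> ('o \<Rightarrow> 'n)"

definition functor_category ::
  "('o, 'm, 'x) category_scheme \<Rightarrow> ('p, 'n, 'y) category_scheme \<Rightarrow>
   (('o, 'm, 'p, 'n) cat_functor, ('o, 'm, 'p, 'n) transformation) category" where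
  "functor_category C D =
    \<lparr>Obj = {F. is_functor C D F},
     Arr = {(F, G, \<eta>). nat_trans C D F G \<eta>},
     Dom = (\<lambda>(F, G, \<eta>). F),
     Cod = (\<lambda>(F, G, \<eta>). G),
     Ident = (\<lambda>F. (F, F, \<lambda>a \<in> Obj C. Ident D (FObj F a))),
     Comp = (\<lambda>(G, H, \<theta>) (F, G', \<eta>). (F, H, \<lambda>a \<in> Obj C. \<theta> a \<cdot>\<^bsub>D\<^esub> \<eta> a))\<rparr>"

text \<open>For \<open>Q\<close> a functor from \<open>C\<close> to \<open>L\<close>, precomposition with \<open>Q\<close> is a functor from
  \<open>[L, D]\<close> to \<open>[C, D]\<close>.\<close>

definition precomposition ::
  "('o, 'm, 'x) category_scheme \<Rightarrow> ('q, 'k, 'z) category_scheme \<Rightarrow>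
   ('p, 'n, 'y) category_scheme \<Rightarrow> ('o, 'm, 'q, 'k) cat_functor \<Rightarrow>
   (('q, 'k, 'p, 'n) cat_functor, ('q, 'k, 'p, 'n) transformation,
    ('o, 'm, 'p, 'n) cat_functor, ('o, 'm, 'p, 'n) transformation) cat_functor" where
  "precomposition C L D Q =
    \<lparr>FObj = (\<lambda>F \<in> Obj (functor_category L D). functor_comp C F Q),
     FArr = (\<lambda>(F, G, \<eta>) \<in> Arr (functor_category L D).
       (functor_comp C F Q, functor_comp C G Q, compose (Obj C) \<eta> (FObj Q)))\<rparr>"


section \<open>Localisation\<close>

text \<open>HOL cannot quantify over types inside a formula. The type arguments \<open>'p\<close> and \<open>'n\<close> are the
  types of objects and morphisms of the test categories \<open>D\<close>; a theorem asserting
  \<open>is_localisation TYPE('p) TYPE('n) \<dots>\<close> with both type variables free speaks about all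
  test categories.\<close>

definition is_localisation ::
  "'p itself \<Rightarrow> 'n itself \<Rightarrow> ('o, 'm, 'x) category_scheme \<Rightarrow> 'm set \<Rightarrow>
   ('q, 'k, 'z) category_scheme \<Rightarrow> ('o, 'm, 'q, 'k) cat_functor \<Rightarrow> bool" where
  "is_localisation (_ :: 'p itself) (_ :: 'n itself) C \<Sigma> L Q \<longleftrightarrow>
    category C \<and> \<Sigma> \<subseteq> Arr C \<and> category L \<and> is_functor C L Q \<and>
    (\<forall>f \<in> \<Sigma>. is_iso L (FArr Q f)) \<and>
    (\<forall>(D :: ('p, 'n) category) R.
      is_functor C D R \<and> (\<forall>f \<in> \<Sigma>. is_iso D (FArr R f)) \<longrightarrow>
      (\<exists>R'. is_functor L D R' \<and> naturally_isomorphic C D (functor_comp C R' Q) R)) \<and>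
    (\<forall>D :: ('p, 'n) category. category D \<longrightarrow>
      full_functor (functor_category L D) (functor_category C D) (precomposition C L D Q) \<and>
      faithful_functor (functor_category L D) (functor_category C D) (precomposition C L D Q))"


section \<open>Monoidal categories\<close>

record ('o, 'm) monoidal_category = "('o, 'm) category" +
  TObj :: "'o \<Rightarrow> 'o \<Rightarrow> 'o" (infixl "\<otimes>\<^sub>o\<index>" 70)
  TArr :: "'m \<Rightarrow> 'm \<Rightarrow> 'm" (infixl "\<otimes>\<index>" 70)
  Unit :: "'o"
  Assoc :: "'o \<Rightarrow> 'o \<Rightarrow> 'o \<Rightarrow> 'm"
  LUnit :: "'o \<Rightarrow> 'm"
  RUnit :: "'o \<Rightarrow> 'm"

locale monoidal_category = category C
  for C :: "('o, 'm, 'x) monoidal_category_scheme" (structure) +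
  assumes TObj_in_Obj: "\<lbrakk>a \<in> Obj C; b \<in> Obj C\<rbrakk> \<Longrightarrow> a \<otimes>\<^sub>o b \<in> Obj C"
    and TArr_in_hom: "\<lbrakk>f \<in> hom C a b; g \<in> hom C c d\<rbrakk>
      \<Longrightarrow> f \<otimes> g \<in> hom C (a \<otimes>\<^sub>o c) (b \<otimes>\<^sub>o d)"
    and TArr_Ident: "\<lbrakk>a \<in> Obj C; b \<in> Obj C\<rbrakk>
      \<Longrightarrow> Ident C a \<otimes> Ident C b = Ident C (a \<otimes>\<^sub>o b)"
    and TArr_Comp: "\<lbrakk>f \<in> hom C a b; g \<in> hom C b c; f' \<in> hom C a' b'; g' \<in> hom C b' c'\<rbrakk>
      \<Longrightarrow> (g \<cdot> f) \<otimes> (g' \<cdot> f') = (g \<otimes> g') \<cdot> (f \<otimes> f')"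
    and Unit_in_Obj: "Unit C \<in> Obj C"
    and Assoc_in_hom: "\<lbrakk>a \<in> Obj C; b \<in> Obj C; c \<in> Obj C\<rbrakk>
      \<Longrightarrow> Assoc C a b c \<in> hom C ((a \<otimes>\<^sub>o b) \<otimes>\<^sub>o c) (a \<otimes>\<^sub>o (b \<otimes>\<^sub>o c))"
    and Assoc_iso: "\<lbrakk>a \<in> Obj C; b \<in> Obj C; c \<in> Obj C\<rbrakk> \<Longrightarrow> is_iso C (Assoc C a b c)"
    and Assoc_natural: "\<lbrakk>f \<in> hom C a a'; g \<in> hom C b b'; h \<in> hom C c c'\<rbrakk>
      \<Longrightarrow> Assoc C a' b' c' \<cdot> ((f \<otimes> g) \<otimes> h) = (f \<otimes> (g \<otimes> h)) \<cdot> Assoc C a b c"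
    and LUnit_in_hom: "a \<in> Obj C \<Longrightarrow> LUnit C a \<in> hom C (Unit C \<otimes>\<^sub>o a) a"
    and LUnit_iso: "a \<in> Obj C \<Longrightarrow> is_iso C (LUnit C a)"
    and LUnit_natural: "f \<in> hom C a b
      \<Longrightarrow> LUnit C b \<cdot> (Ident C (Unit C) \<otimes> f) = f \<cdot> LUnit C a"
    and RUnit_in_hom: "a \<in> Obj C \<Longrightarrow> RUnit C a \<in> hom C (a \<otimes>\<^sub>o Unit C) a"
    and RUnit_iso: "a \<in> Obj C \<Longrightarrow> is_iso C (RUnit C a)"
    and RUnit_natural: "f \<in> hom C a b
      \<Longrightarrow> RUnit C b \<cdot> (f \<otimes> Ident C (Unit C)) = f \<cdot> RUnit C a"
    and triangle: "\<lbrakk>a \<in> Obj C; b \<in> Obj C\<rbrakk>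
      \<Longrightarrow> (Ident C a \<otimes> LUnit C b) \<cdot> Assoc C a (Unit C) b = RUnit C a \<otimes> Ident C b"
    and pentagon: "\<lbrakk>a \<in> Obj C; b \<in> Obj C; c \<in> Obj C; d \<in> Obj C\<rbrakk>
      \<Longrightarrow> Assoc C a b (c \<otimes>\<^sub>o d) \<cdot> Assoc C (a \<otimes>\<^sub>o b) c d =
          ((Ident C a \<otimes> Assoc C b c d) \<cdot> Assoc C a (b \<otimes>\<^sub>o c) d) \<cdot>
          (Assoc C a b c \<otimes> Ident C d)"


section \<open>Subunits\<close>

definition factors_through :: "('o, 'm, 'x) category_scheme \<Rightarrow> 'm \<Rightarrow> 'm \<Rightarrow> bool" where
  "factors_through C s t \<longleftrightarrow> (\<exists>h \<in> hom C (Dom C s) (Dom C t). s = t \<cdot>\<^bsub>C\<^esub> h)"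

definition monos_into :: "('o, 'm, 'x) category_scheme \<Rightarrow> 'o \<Rightarrow> 'm set" where
  "monos_into C a = {s. is_mono C s \<and> Cod C s = a}"

definition mono_equiv :: "('o, 'm, 'x) category_scheme \<Rightarrow> 'o \<Rightarrow> ('m \<times> 'm) set" where
  "mono_equiv C a = {(s, t). s \<in> monos_into C a \<and> t \<in> monos_into C a \<and>
    factors_through C s t \<and> factors_through C t s}"

definition subobjects :: "('o, 'm, 'x) category_scheme \<Rightarrow> 'o \<Rightarrow> 'm set set" where
  "subobjects C a = monos_into C a // mono_equiv C a"

definition subunits :: "('o, 'm, 'x) monoidal_category_scheme \<Rightarrow> 'm set set" where
  "subunits C = subobjects C (Unit C)"

text \<open>The next three notions are stated for a monomorphism \<open>s\<close> representing a subunit.\<close>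

definition idempotent_subunit :: "('o, 'm, 'x) monoidal_category_scheme \<Rightarrow> 'm \<Rightarrow> bool" where
  "idempotent_subunit C s \<longleftrightarrow> is_iso C (s \<otimes>\<^bsub>C\<^esub> Ident C (Dom C s))"

definition restriction ::
  "('o, 'm, 'x) monoidal_category_scheme \<Rightarrow> 'm \<Rightarrow> ('o, 'm) category" where
  "restriction C s = full_subcategory C {a \<in> Obj C. is_iso C (Ident C a \<otimes>\<^bsub>C\<^esub> s)}"

definition restriction_functor ::
  "('o, 'm, 'x) monoidal_category_scheme \<Rightarrow> 'm \<Rightarrow> ('o, 'm, 'o, 'm) cat_functor" where
  "restriction_functor C s =
    \<lparr>FObj = (\<lambda>a \<in> Obj C. a \<otimes>\<^sub>o\<^bsub>C\<^esub> Dom C s),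
     FArr = (\<lambda>f \<in> Arr C. f \<otimes>\<^bsub>C\<^esub> Ident C (Dom C s))\<rparr>"

end

theory Submission
  imports Defs
begin

text \<open>
  Write \<open>Q\<close> for \<open>E \<mapsto> E \<otimes> S\<close>, and let \<open>e\<^sub>E : E \<otimes> S \<rightarrow> E\<close> be \<open>E \<otimes> s\<close> followed by the right unitor.
  The morphisms \<open>e\<^sub>E\<close> are natural in \<open>E\<close>, they are invertible precisely on the objects of the
  restricted category, and, up to the unitor, they are the morphisms to be inverted. So \<open>Q\<close> behaves
  like a coreflection with counit \<open>e\<close>, and a coreflection is a localisation at its counit:
  a functor \<open>R\<close> inverting \<open>e\<close> is isomorphic to its own restriction composed with \<open>Q\<close>, through
  \<open>R e\<close>; and a transformation \<open>\<eta> : F Q \<rightarrow> G Q\<close> comes from exactly one \<open>\<theta> : F \<rightarrow> G\<close>, since naturality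
  at \<open>e\<^sub>E\<close> forces \<open>\<theta>\<^sub>E\<close> to be the inverse of \<open>F(e\<^sub>E)\<close> followed by \<open>\<eta>\<^sub>E\<close> and \<open>G(e\<^sub>E)\<close>. This is carried out for
  an arbitrary full subcategory in the locale \<open>inverting_coreflection\<close>. The one coherence condition
  that is needed, \<open>Q e = e Q\<close>, follows formally from naturality and invertibility
  (\<open>Q_counit\<close>).

  What is specific to subunits is that \<open>E \<otimes> S\<close> lies in the restricted category. Idempotence says
  that \<open>s \<otimes> S\<close> is invertible, whereas \<open>S \<otimes> s\<close> has to be. There is no braiding, but both tensors
  become \<open>s \<otimes> s\<close> after composing with \<open>s\<close> and identifying \<open>I \<otimes> I\<close> with \<open>I\<close>; since \<open>s\<close> is monic,
  they agree up to unitors (\<open>absorptions_agree\<close>). This comparison uses Kelly's theorem that the left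
  and right unitors coincide on \<open>I\<close> (\<open>LUnit_Unit\<close>).
\<close>

section \<open>Isomorphisms and full subcategories\<close>

context category
begin

lemma Ident_simps [simp]:
  assumes "a \<in> Obj C"
  shows "Ident C a \<in> Arr C" "Dom C (Ident C a) = a" "Cod C (Ident C a) = a"
  using Ident_in_hom[OF assms] by (auto simp: hom_def)

lemma Comp_simps [simp]:
  assumes "f \<in> Arr C" "g \<in> Arr C" "Dom C g = Cod C f"
  shows "g \<cdot> f \<in> Arr C" "Dom C (g \<cdot> f) = Dom C f" "Cod C (g \<cdot> f) = Cod C g"
  using Comp_in_hom[of f "Dom C f" "Cod C f" g "Cod C g"] assms by (auto simp: hom_def)

lemma Dom_Cod_Obj [simp]:
  assumes "f \<in> Arr C"
  shows "Dom C f \<in> Obj C" "Cod C f \<in> Obj C"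
  using assms Dom_in_Obj Cod_in_Obj by auto

lemma Comp_Ident_simps [simp]:
  assumes "f \<in> Arr C"
  shows "Dom C f = a \<Longrightarrow> f \<cdot> Ident C a = f" "Cod C f = a \<Longrightarrow> Ident C a \<cdot> f = f"
  using assms Comp_Ident[of f "Dom C f" "Cod C f"] Ident_Comp[of f "Dom C f" "Cod C f"]
  by (auto simp: hom_def)

lemma assoc:
  assumes "f \<in> Arr C" "g \<in> Arr C" "h \<in> Arr C" "Dom C g = Cod C f" "Dom C h = Cod C g"
  shows "(h \<cdot> g) \<cdot> f = h \<cdot> (g \<cdot> f)"
  using Comp_assoc[of f "Dom C f" "Cod C f" g "Cod C g" h "Cod C h"] assms by (auto simp: hom_def)

lemma is_isoE:
  assumes "is_iso C f"
  obtains g where "f \<in> Arr C" "g \<in> Arr C" "Dom C g = Cod C f" "Cod C g = Dom C f"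
    "g \<cdot> f = Ident C (Dom C f)" "f \<cdot> g = Ident C (Cod C f)"
  using assms unfolding is_iso_def hom_def by blast

lemma is_isoI:
  assumes "f \<in> Arr C" "g \<in> Arr C" "Dom C g = Cod C f" "Cod C g = Dom C f"
    "g \<cdot> f = Ident C (Dom C f)" "f \<cdot> g = Ident C (Cod C f)"
  shows "is_iso C f"
  using assms unfolding is_iso_def hom_def by blast

lemma is_iso_Ident: "a \<in> Obj C \<Longrightarrow> is_iso C (Ident C a)"
  by (rule is_isoI[where g = "Ident C a"]) auto

lemma is_iso_Comp:
  assumes f: "is_iso C f" and g: "is_iso C g" and seq: "Dom C g = Cod C f"
  shows "is_iso C (g \<cdot> f)"
proof -
  obtain f' where f': "f \<in> Arr C" "f' \<in> Arr C" "Dom C f' = Cod C f" "Cod C f' = Dom C f"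
      "f' \<cdot> f = Ident C (Dom C f)" "f \<cdot> f' = Ident C (Cod C f)"
    using f by (rule is_isoE)
  obtain g' where g': "g \<in> Arr C" "g' \<in> Arr C" "Dom C g' = Cod C g" "Cod C g' = Dom C g"
      "g' \<cdot> g = Ident C (Dom C g)" "g \<cdot> g' = Ident C (Cod C g)"
    using g by (rule is_isoE)
  have "(f' \<cdot> g') \<cdot> (g \<cdot> f) = f' \<cdot> ((g' \<cdot> g) \<cdot> f)"
    using f'(1-4) g'(1-4) seq by (simp add: assoc)
  moreover have "(g \<cdot> f) \<cdot> (f' \<cdot> g') = g \<cdot> ((f \<cdot> f') \<cdot> g')"
    using f'(1-4) g'(1-4) seq by (simp add: assoc)
  ultimately show ?thesis
    using f' g' seq by (intro is_isoI[where g = "f' \<cdot> g'"]) auto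
qed

lemma iso_cancel_left:
  assumes g: "is_iso C g" and f: "f \<in> Arr C" "f' \<in> Arr C" "Cod C f = Dom C g" "Cod C f' = Dom C g"
    and eq: "g \<cdot> f = g \<cdot> f'"
  shows "f = f'"
proof -
  obtain h where h: "g \<in> Arr C" "h \<in> Arr C" "Dom C h = Cod C g" "h \<cdot> g = Ident C (Dom C g)"
    using g by (rule is_isoE)
  have "(h \<cdot> g) \<cdot> f = (h \<cdot> g) \<cdot> f'"
    using h(1-3) f eq by (simp add: assoc)
  then show ?thesis
    using h f by simp
qed

lemma iso_cancel_right:
  assumes g: "is_iso C g" and f: "f \<in> Arr C" "f' \<in> Arr C" "Dom C f = Cod C g" "Dom C f' = Cod C g"
    and eq: "f \<cdot> g = f' \<cdot> g"
  shows "f = f'"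
proof -
  obtain h where h: "g \<in> Arr C" "h \<in> Arr C" "Dom C h = Cod C g" "Cod C h = Dom C g"
      "g \<cdot> h = Ident C (Cod C g)"
    using g by (rule is_isoE)
  have "f \<cdot> (g \<cdot> h) = f' \<cdot> (g \<cdot> h)"
    using h(1-4) f eq by (simp flip: assoc)
  then show ?thesis
    using h f by simp
qed

lemma extend_along_iso:
  assumes f: "is_iso C f" and x: "x \<in> Arr C" "Dom C x = Dom C f"
  shows "\<exists>h \<in> Arr C. Dom C h = Cod C f \<and> Cod C h = Cod C x \<and> h \<cdot> f = x"
proof -
  obtain g where g: "f \<in> Arr C" "g \<in> Arr C" "Dom C g = Cod C f" "Cod C g = Dom C f"
      "g \<cdot> f = Ident C (Dom C f)"
    using f by (rule is_isoE)
  then have "(x \<cdot> g) \<cdot> f = x"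
    using x by (simp add: assoc)
  then show ?thesis
    using g x by (intro bexI[of _ "x \<cdot> g"]) auto
qed

lemma is_iso_left_factor:
  assumes g: "is_iso C g" and gf: "is_iso C (g \<cdot> f)" and f: "f \<in> Arr C" "Cod C f = Dom C g"
  shows "is_iso C f"
proof -
  obtain g' where g': "g \<in> Arr C" "g' \<in> Arr C" "Dom C g' = Cod C g" "Cod C g' = Dom C g"
      "g' \<cdot> g = Ident C (Dom C g)" "g \<cdot> g' = Ident C (Cod C g)"
    using g by (rule is_isoE)
  have "is_iso C (g' \<cdot> (g \<cdot> f))"
    using g' f by (intro is_iso_Comp[OF gf] is_isoI[of g' g]) auto
  moreover have "g' \<cdot> (g \<cdot> f) = (g' \<cdot> g) \<cdot> f"
    using g'(1-4) f by (simp add: assoc)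
  ultimately show ?thesis
    using g' f by simp
qed

end

lemma full_subcategory_simps [simp]:
  "Obj (full_subcategory C A) = Obj C \<inter> A"
  "f \<in> Arr (full_subcategory C A) \<longleftrightarrow> f \<in> Arr C \<and> Dom C f \<in> A \<and> Cod C f \<in> A"
  "Dom (full_subcategory C A) = Dom C"
  "Cod (full_subcategory C A) = Cod C"
  "Ident (full_subcategory C A) = Ident C"
  "Comp (full_subcategory C A) = Comp C"
  by (simp_all add: full_subcategory_def)

lemma category_full_subcategory:
  assumes "category C"
  shows "category (full_subcategory C A)"
proof -
  interpret category C by fact
  show ?thesis
    by unfold_locales (auto simp: hom_def assoc)
qed

lemma is_iso_full_subcategory [simp]:
  "is_iso (full_subcategory C A) f \<longleftrightarrow> is_iso C f \<and> Dom C f \<in> A \<and> Cod C f \<in> A"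
  by (auto simp: is_iso_def hom_def)


section \<open>Functors and functor categories\<close>

context is_functor
begin

lemma FObj_simp [simp]: "a \<in> Obj C \<Longrightarrow> FObj F a \<in> Obj D"
  by (rule FObj_in_Obj)

lemma FArr_simps [simp]:
  assumes "f \<in> Arr C"
  shows "FArr F f \<in> Arr D" "Dom D (FArr F f) = FObj F (Dom C f)"
    "Cod D (FArr F f) = FObj F (Cod C f)"
  using FArr_in_hom[of f "Dom C f" "Cod C f"] assms by (auto simp: hom_def)

lemma FArr_Comp': "\<lbrakk>f \<in> Arr C; g \<in> Arr C; Dom C g = Cod C f\<rbrakk>
    \<Longrightarrow> FArr F (g \<cdot>\<^bsub>C\<^esub> f) = FArr F g \<cdot>\<^bsub>D\<^esub> FArr F f"
  using FArr_Comp[of f "Dom C f" "Cod C f" g "Cod C g"] by (auto simp: hom_def)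

lemma FArr_iso:
  assumes "is_iso C f"
  shows "is_iso D (FArr F f)"
proof -
  obtain g where g: "f \<in> Arr C" "g \<in> Arr C" "Dom C g = Cod C f" "Cod C g = Dom C f"
      "g \<cdot>\<^bsub>C\<^esub> f = Ident C (Dom C f)" "f \<cdot>\<^bsub>C\<^esub> g = Ident C (Cod C f)"
    using assms by (rule source.is_isoE)
  then show ?thesis
    by (intro target.is_isoI[where g = "FArr F g"]) (simp_all add: FArr_Ident flip: FArr_Comp')
qed

end

context nat_trans
begin

lemma component_simps [simp]:
  assumes "a \<in> Obj C"
  shows "\<eta> a \<in> Arr D" "Dom D (\<eta> a) = FObj F a" "Cod D (\<eta> a) = FObj G a"
  using component_in_hom[OF assms] by (auto simp: hom_def)

lemma naturality': "f \<in> Arr C \<Longrightarrow> \<eta> (Cod C f) \<cdot>\<^bsub>D\<^esub> FArr F f = FArr G f \<cdot>\<^bsub>D\<^esub> \<eta> (Dom C f)"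
  by (rule naturality) (simp add: hom_def)

end

lemma nat_transI:
  assumes "is_functor C D F" "is_functor C D G" "\<eta> \<in> extensional (Obj C)"
    and "\<And>a. a \<in> Obj C \<Longrightarrow> \<eta> a \<in> Arr D \<and> Dom D (\<eta> a) = FObj F a \<and> Cod D (\<eta> a) = FObj G a"
    and "\<And>f. f \<in> Arr C \<Longrightarrow> \<eta> (Cod C f) \<cdot>\<^bsub>D\<^esub> FArr F f = FArr G f \<cdot>\<^bsub>D\<^esub> \<eta> (Dom C f)"
  shows "nat_trans C D F G \<eta>"
  using assms unfolding nat_trans_def nat_trans_axioms_def hom_def by auto

lemma functor_comp_simps [simp]:
  "a \<in> Obj C \<Longrightarrow> FObj (functor_comp C G F) a = FObj G (FObj F a)"
  "f \<in> Arr C \<Longrightarrow> FArr (functor_comp C G F) f = FArr G (FArr F f)"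
  by (simp_all add: functor_comp_def compose_def)

lemma is_functor_comp:
  assumes "is_functor B C F" "is_functor C D G"
  shows "is_functor B D (functor_comp B G F)"
proof -
  interpret F: is_functor B C F by fact
  interpret G: is_functor C D G by fact
  show ?thesis
  proof unfold_locales
    show "FObj (functor_comp B G F) \<in> extensional (Obj B)"
      "FArr (functor_comp B G F) \<in> extensional (Arr B)"
      by (auto simp: functor_comp_def compose_def)
  qed (auto simp: hom_def F.FArr_Ident G.FArr_Ident F.FArr_Comp' G.FArr_Comp')
qed

lemma nat_trans_Ident:
  assumes "is_functor C D F"
  shows "nat_trans C D F F (\<lambda>a \<in> Obj C. Ident D (FObj F a))"
proof -
  interpret is_functor C D F by fact
  show ?thesis
    by (rule nat_transI) (use assms in auto)
qed

lemma nat_trans_Comp: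
  assumes "nat_trans C D F G \<eta>" "nat_trans C D G H \<theta>"
  shows "nat_trans C D F H (\<lambda>a \<in> Obj C. \<theta> a \<cdot>\<^bsub>D\<^esub> \<eta> a)"
proof -
  interpret \<eta>: nat_trans C D F G \<eta> by fact
  interpret \<theta>: nat_trans C D G H \<theta> by fact
  show ?thesis
  proof (rule nat_transI)
    fix f assume f: "f \<in> Arr C"
    let ?a = "Dom C f" and ?b = "Cod C f"
    have "(\<theta> ?b \<cdot>\<^bsub>D\<^esub> \<eta> ?b) \<cdot>\<^bsub>D\<^esub> FArr F f = \<theta> ?b \<cdot>\<^bsub>D\<^esub> (FArr G f \<cdot>\<^bsub>D\<^esub> \<eta> ?a)"
      using f by (simp add: \<eta>.source_functor.target.assoc \<eta>.naturality')
    also have "\<dots> = (FArr H f \<cdot>\<^bsub>D\<^esub> \<theta> ?a) \<cdot>\<^bsub>D\<^esub> \<eta> ?a"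
      using f by (simp flip: \<eta>.source_functor.target.assoc \<theta>.naturality')
    also have "\<dots> = FArr H f \<cdot>\<^bsub>D\<^esub> (\<theta> ?a \<cdot>\<^bsub>D\<^esub> \<eta> ?a)"
      using f by (simp add: \<eta>.source_functor.target.assoc)
    finally show "(\<lambda>a \<in> Obj C. \<theta> a \<cdot>\<^bsub>D\<^esub> \<eta> a) ?b \<cdot>\<^bsub>D\<^esub> FArr F f =
        FArr H f \<cdot>\<^bsub>D\<^esub> (\<lambda>a \<in> Obj C. \<theta> a \<cdot>\<^bsub>D\<^esub> \<eta> a) ?a"
      using f by simp
  qed (use \<eta>.source_functor.is_functor_axioms \<theta>.target_functor.is_functor_axioms in auto)
qed

lemma nat_trans_whisker:
  assumes "is_functor B C Q" "nat_trans C D F G \<eta>"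
  shows "nat_trans B D (functor_comp B F Q) (functor_comp B G Q) (compose (Obj B) \<eta> (FObj Q))"
proof -
  interpret Q: is_functor B C Q by fact
  interpret \<eta>: nat_trans C D F G \<eta> by fact
  show ?thesis
  proof (rule nat_transI)
    fix f assume "f \<in> Arr B"
    then show "compose (Obj B) \<eta> (FObj Q) (Cod B f) \<cdot>\<^bsub>D\<^esub> FArr (functor_comp B F Q) f =
        FArr (functor_comp B G Q) f \<cdot>\<^bsub>D\<^esub> compose (Obj B) \<eta> (FObj Q) (Dom B f)"
      using \<eta>.naturality'[of "FArr Q f"] by (simp add: compose_def)
  qed (use assms(1) \<eta>.source_functor.is_functor_axioms \<eta>.target_functor.is_functor_axioms
      in \<open>auto simp: compose_def intro: is_functor_comp\<close>)
qed

lemma functor_category_simps [simp]: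
  "F \<in> Obj (functor_category C D) \<longleftrightarrow> is_functor C D F"
  "(F, G, \<eta>) \<in> Arr (functor_category C D) \<longleftrightarrow> nat_trans C D F G \<eta>"
  "Dom (functor_category C D) (F, G, \<eta>) = F"
  "Cod (functor_category C D) (F, G, \<eta>) = G"
  "Ident (functor_category C D) F = (F, F, \<lambda>a \<in> Obj C. Ident D (FObj F a))"
  "(G', H, \<theta>) \<cdot>\<^bsub>functor_category C D\<^esub> (F, G, \<eta>) = (F, H, \<lambda>a \<in> Obj C. \<theta> a \<cdot>\<^bsub>D\<^esub> \<eta> a)"
  by (simp_all add: functor_category_def)

lemma hom_functor_category:
  "x \<in> hom (functor_category C D) F G \<longleftrightarrow> (\<exists>\<eta>. x = (F, G, \<eta>) \<and> nat_trans C D F G \<eta>)"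
  by (cases x) (auto simp: hom_def)

lemma category_functor_category: "category (functor_category C D)"
proof
  fix f assume "f \<in> Arr (functor_category C D)"
  then obtain F G \<eta> where f: "f = (F, G, \<eta>)" and "nat_trans C D F G \<eta>"
    by (cases f) auto
  then interpret nat_trans C D F G \<eta> by simp
  show "Dom (functor_category C D) f \<in> Obj (functor_category C D)"
    "Cod (functor_category C D) f \<in> Obj (functor_category C D)"
    using f source_functor.is_functor_axioms target_functor.is_functor_axioms by auto
next
  fix F assume "F \<in> Obj (functor_category C D)"
  then show "Ident (functor_category C D) F \<in> hom (functor_category C D) F F"
    by (simp add: hom_functor_category nat_trans_Ident)
next
  fix f g F G H
  assume "f \<in> hom (functor_category C D) F G" "g \<in> hom (functor_category C D) G H"
  then show "g \<cdot>\<^bsub>functor_category C D\<^esub> f \<in> hom (functor_category C D) F H"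
    by (auto simp: hom_functor_category intro: nat_trans_Comp)
next
  fix f F G
  assume "f \<in> hom (functor_category C D) F G"
  then obtain \<eta> where f: "f = (F, G, \<eta>)" and "nat_trans C D F G \<eta>"
    by (auto simp: hom_functor_category)
  then interpret nat_trans C D F G \<eta> by simp
  show "f \<cdot>\<^bsub>functor_category C D\<^esub> Ident (functor_category C D) F = f"
    "Ident (functor_category C D) G \<cdot>\<^bsub>functor_category C D\<^esub> f = f"
    using component_extensional by (auto simp: f fun_eq_iff extensional_def)
next
  fix f g h F G H K
  assume "f \<in> hom (functor_category C D) F G" "g \<in> hom (functor_category C D) G H"
    "h \<in> hom (functor_category C D) H K"
  then obtain \<eta> \<theta> \<zeta> where fgh: "f = (F, G, \<eta>)" "g = (G, H, \<theta>)" "h = (H, K, \<zeta>)"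
    and nat: "nat_trans C D F G \<eta>" "nat_trans C D G H \<theta>" "nat_trans C D H K \<zeta>"
    by (auto simp: hom_functor_category)
  interpret \<eta>: nat_trans C D F G \<eta> by fact
  interpret \<theta>: nat_trans C D G H \<theta> by fact
  interpret \<zeta>: nat_trans C D H K \<zeta> by fact
  show "(h \<cdot>\<^bsub>functor_category C D\<^esub> g) \<cdot>\<^bsub>functor_category C D\<^esub> f =
      h \<cdot>\<^bsub>functor_category C D\<^esub> (g \<cdot>\<^bsub>functor_category C D\<^esub> f)"
    by (auto simp: fgh fun_eq_iff \<eta>.source_functor.target.assoc)
qed

lemma precomposition_simps [simp]:
  "is_functor L D F \<Longrightarrow> FObj (precomposition C L D Q) F = functor_comp C F Q"
  "nat_trans L D F G \<eta> \<Longrightarrow> FArr (precomposition C L D Q) (F, G, \<eta>) =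
    (functor_comp C F Q, functor_comp C G Q, compose (Obj C) \<eta> (FObj Q))"
  by (simp_all add: precomposition_def)

lemma is_functor_precomposition:
  assumes Q: "is_functor C L Q"
  shows "is_functor (functor_category L D) (functor_category C D) (precomposition C L D Q)"
proof -
  interpret Q: is_functor C L Q by fact
  show ?thesis
  proof (intro is_functor.intro is_functor_axioms.intro category_functor_category)
    show "FObj (precomposition C L D Q) \<in> extensional (Obj (functor_category L D))"
      "FArr (precomposition C L D Q) \<in> extensional (Arr (functor_category L D))"
      by (simp_all add: precomposition_def)
  next
    fix F assume "F \<in> Obj (functor_category L D)"
    then show "FObj (precomposition C L D Q) F \<in> Obj (functor_category C D)"
      "FArr (precomposition C L D Q) (Ident (functor_category L D) F) =
        Ident (functor_category C D) (FObj (precomposition C L D Q) F)"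
      using Q by (auto simp: is_functor_comp nat_trans_Ident compose_def fun_eq_iff)
  next
    fix f F G assume "f \<in> hom (functor_category L D) F G"
    then obtain \<eta> where f: "f = (F, G, \<eta>)" and \<eta>: "nat_trans L D F G \<eta>"
      by (auto simp: hom_functor_category)
    then interpret nat_trans L D F G \<eta> by simp
    show "FArr (precomposition C L D Q) f \<in> hom (functor_category C D)
        (FObj (precomposition C L D Q) F) (FObj (precomposition C L D Q) G)"
      using nat_trans_whisker[OF Q \<eta>] source_functor.is_functor_axioms
        target_functor.is_functor_axioms \<eta>
      by (simp add: f hom_functor_category)
  next
    fix f g F G H
    assume "f \<in> hom (functor_category L D) F G" "g \<in> hom (functor_category L D) G H"
    then show "FArr (precomposition C L D Q) (g \<cdot>\<^bsub>functor_category L D\<^esub> f) =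
        FArr (precomposition C L D Q) g \<cdot>\<^bsub>functor_category C D\<^esub> FArr (precomposition C L D Q) f"
      by (auto simp: hom_functor_category nat_trans_Comp compose_def fun_eq_iff)
  qed
qed

lemma is_functor_restrict:
  assumes "is_functor C D R"
  shows "is_functor (full_subcategory C A) D
    \<lparr>FObj = restrict (FObj R) (Obj C \<inter> A), FArr = restrict (FArr R) (Arr (full_subcategory C A))\<rparr>"
proof -
  interpret is_functor C D R by fact
  interpret L: category "full_subcategory C A"
    by (rule category_full_subcategory) unfold_locales
  show ?thesis
    by unfold_locales (auto simp: hom_def FArr_Ident FArr_Comp')
qed


section \<open>Localisation along a coreflection\<close>

text \<open>
  The functor \<open>Q\<close> into the full subcategory on \<open>A\<close> comes with a transformation \<open>e\<close> from \<open>Q\<close>, seen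
  as an endofunctor of \<open>C\<close>, to the identity. The universal property of a coreflection is replaced by
  conditions that can be checked without solving lifting problems: \<open>e\<close> is invertible on \<open>A\<close>, and
  \<open>Q\<close> inverts \<open>\<Sigma>\<close>, hence also \<open>e\<close>. The components of \<open>e\<close> are elements of \<open>\<Sigma>\<close> only up to an
  isomorphism, which leaves room for the unitors.
\<close>

locale inverting_coreflection = is_functor C "full_subcategory C A" Q
  for C :: "('o, 'm, 'x) category_scheme" (structure) and A and Q +
  fixes e :: "'o \<Rightarrow> 'm" and \<Sigma> :: "'m set"
  assumes counit_in_hom: "a \<in> Obj C \<Longrightarrow> e a \<in> hom C (FObj Q a) a"
    and counit_natural: "f \<in> Arr C \<Longrightarrow> e (Cod C f) \<cdot> FArr Q f = f \<cdot> e (Dom C f)"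
    and counit_iso: "a \<in> Obj C \<Longrightarrow> a \<in> A \<Longrightarrow> is_iso C (e a)"
    and counit_factor: "a \<in> Obj C \<Longrightarrow>
      \<exists>f \<in> \<Sigma>. \<exists>g. is_iso C g \<and> Dom C g = Cod C f \<and> e a = g \<cdot> f"
    and \<Sigma>_Arr: "\<Sigma> \<subseteq> Arr C"
    and Q_inverts: "f \<in> \<Sigma> \<Longrightarrow> is_iso C (FArr Q f)"
begin

lemma counit_simps [simp]:
  assumes "a \<in> Obj C"
  shows "e a \<in> Arr C" "Dom C (e a) = FObj Q a" "Cod C (e a) = a"
  using counit_in_hom[OF assms] by (auto simp: hom_def)

lemma Q_simps [simp]:
  "a \<in> Obj C \<Longrightarrow> FObj Q a \<in> Obj C" "a \<in> Obj C \<Longrightarrow> FObj Q a \<in> A"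
  "f \<in> Arr C \<Longrightarrow> FArr Q f \<in> Arr C"
  "f \<in> Arr C \<Longrightarrow> Dom C (FArr Q f) = FObj Q (Dom C f)"
  "f \<in> Arr C \<Longrightarrow> Cod C (FArr Q f) = FObj Q (Cod C f)"
  using FObj_in_Obj FArr_simps by auto

lemma counit_inverted:
  assumes "is_functor C D R" and R: "\<And>f. f \<in> \<Sigma> \<Longrightarrow> is_iso D (FArr R f)" and a: "a \<in> Obj C"
  shows "is_iso D (FArr R (e a))"
proof -
  interpret R: is_functor C D R by fact
  obtain f g where fg: "f \<in> \<Sigma>" "is_iso C g" "Dom C g = Cod C f" "e a = g \<cdot> f"
    using counit_factor[OF a] by blast
  have "f \<in> Arr C" "g \<in> Arr C"
    using fg \<Sigma>_Arr by (auto simp: is_iso_def)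
  then show ?thesis
    using fg R R.FArr_iso by (simp add: R.FArr_Comp' R.target.is_iso_Comp)
qed

lemma Q_counit_iso:
  assumes a: "a \<in> Obj C"
  shows "is_iso C (FArr Q (e a))"
proof -
  have "is_iso (full_subcategory C A) (FArr Q (e a))"
    using Q_inverts \<Sigma>_Arr by (intro counit_inverted[OF is_functor_axioms _ a]) (simp add: subset_iff)
  then show ?thesis
    by simp
qed

text \<open>
  Naturality of \<open>e\<close> at \<open>e a\<close> gives the equation after composing with \<open>e a\<close>, which need not be
  monic. The functor \<open>Q\<close> turns \<open>e a\<close> into an isomorphism that can be cancelled, and naturality of
  \<open>e\<close> transports the resulting equation from \<open>Q (Q a)\<close> back to \<open>Q a\<close>, where \<open>e\<close> is invertible.
\<close>

lemma Q_counit: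
  assumes a: "a \<in> Obj C"
  shows "FArr Q (e a) = e (FObj Q a)"
proof -
  let ?q = "FObj Q a" and ?qq = "FObj Q (FObj Q a)"
  have "e a \<cdot> FArr Q (e a) = e a \<cdot> e ?q"
    using counit_natural[of "e a"] a by simp
  then have "FArr Q (e a \<cdot> FArr Q (e a)) = FArr Q (e a \<cdot> e ?q)"
    by simp
  then have "FArr Q (e a) \<cdot> FArr Q (FArr Q (e a)) = FArr Q (e a) \<cdot> FArr Q (e ?q)"
    using a by (simp add: FArr_Comp')
  then have 1: "FArr Q (FArr Q (e a)) = FArr Q (e ?q)"
    by (rule source.iso_cancel_left[OF Q_counit_iso[OF a], rotated -1]) (use a in simp_all)
  have "e ?q \<cdot> FArr Q (e ?q) = e ?q \<cdot> e ?qq"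
    using counit_natural[of "e ?q"] a by simp
  then have 2: "FArr Q (e ?q) = e ?qq"
    by (rule source.iso_cancel_left[OF counit_iso, rotated -1]) (use a in simp_all)
  have "FArr Q (e a) \<cdot> e ?qq = e ?q \<cdot> e ?qq"
    using counit_natural[of "FArr Q (e a)"] a 1 2 by simp
  then show ?thesis
    by (rule source.iso_cancel_right[OF counit_iso, rotated -1]) (use a in simp_all)
qed

text \<open>The extension is the restriction of \<open>R\<close> itself, and \<open>R e\<close> is the comparison isomorphism.\<close>

lemma functor_extends:
  assumes R: "is_functor C D R" and inv: "\<And>f. f \<in> \<Sigma> \<Longrightarrow> is_iso D (FArr R f)"
  shows "\<exists>R'. is_functor (full_subcategory C A) D R' \<and>
    naturally_isomorphic C D (functor_comp C R' Q) R"
proof -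
  interpret R: is_functor C D R by fact
  define R' where "R' = \<lparr>FObj = restrict (FObj R) (Obj C \<inter> A),
    FArr = restrict (FArr R) (Arr (full_subcategory C A))\<rparr>"
  have R': "is_functor (full_subcategory C A) D R'"
    unfolding R'_def by (rule is_functor_restrict[OF R])
  have "nat_trans C D (functor_comp C R' Q) R (\<lambda>a \<in> Obj C. FArr R (e a))"
  proof (rule nat_transI)
    show "is_functor C D (functor_comp C R' Q)"
      by (rule is_functor_comp[OF is_functor_axioms R'])
    fix f assume f: "f \<in> Arr C"
    have "FArr R (e (Cod C f) \<cdot> FArr Q f) = FArr R (f \<cdot> e (Dom C f))"
      by (simp add: counit_natural f)
    then show "(\<lambda>a \<in> Obj C. FArr R (e a)) (Cod C f) \<cdot>\<^bsub>D\<^esub> FArr (functor_comp C R' Q) f =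
        FArr R f \<cdot>\<^bsub>D\<^esub> (\<lambda>a \<in> Obj C. FArr R (e a)) (Dom C f)"
      using f by (simp add: R'_def R.FArr_Comp')
  qed (auto simp: R R'_def)
  moreover have "is_iso D ((\<lambda>a \<in> Obj C. FArr R (e a)) a)" if "a \<in> Obj C" for a
    using counit_inverted[OF R inv that] that by simp
  ultimately show ?thesis
    using R' unfolding naturally_isomorphic_def by blast
qed

text \<open>As \<open>F\<close> sends \<open>e a\<close> to an isomorphism for \<open>a \<in> A\<close>, this determines \<open>\<theta>\<close> from its values on
  the image of \<open>Q\<close>: it gives faithfulness and dictates the definition of \<open>\<theta>\<close> for fullness.\<close>

lemma transformation_determined:
  assumes "nat_trans (full_subcategory C A) D F G \<theta>" and a: "a \<in> Obj C" "a \<in> A"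
  shows "\<theta> a \<cdot>\<^bsub>D\<^esub> FArr F (e a) = FArr G (e a) \<cdot>\<^bsub>D\<^esub> \<theta> (FObj Q a)"
  using nat_trans.naturality'[OF assms(1), of "e a"] a by simp

text \<open>
  The components of \<open>\<theta>\<close> are defined by the equation of \<open>transformation_determined\<close>. Naturality of
  \<open>\<theta>\<close> is checked after composing with the isomorphism \<open>F (e a)\<close>, where it becomes naturality of
  \<open>\<eta>\<close>. That \<open>\<theta>\<close> agrees with \<open>\<eta>\<close> on the image of \<open>Q\<close> is naturality of \<open>\<eta>\<close> at \<open>e c\<close> combined
  with \<open>Q e = e Q\<close>.
\<close>

lemma transformation_extends:
  assumes F: "is_functor (full_subcategory C A) D F" and G: "is_functor (full_subcategory C A) D G"
    and "nat_trans C D (functor_comp C F Q) (functor_comp C G Q) \<eta>"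
  shows "\<exists>\<theta>. nat_trans (full_subcategory C A) D F G \<theta> \<and> \<eta> = compose (Obj C) \<theta> (FObj Q)"
proof -
  interpret F: is_functor "full_subcategory C A" D F by fact
  interpret G: is_functor "full_subcategory C A" D G by fact
  interpret \<eta>: nat_trans C D "functor_comp C F Q" "functor_comp C G Q" \<eta> by fact
  note D_assoc = F.target.assoc
  have Fe_iso: "is_iso D (FArr F (e a))" if "a \<in> Obj C" "a \<in> A" for a
    using that by (intro F.FArr_iso) (simp add: counit_iso)
  have "\<exists>h. h \<in> Arr D \<and> Dom D h = FObj F a \<and> Cod D h = FObj G a \<and>
      h \<cdot>\<^bsub>D\<^esub> FArr F (e a) = FArr G (e a) \<cdot>\<^bsub>D\<^esub> \<eta> a" if "a \<in> Obj C" "a \<in> A" for a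
    using F.target.extend_along_iso[OF Fe_iso[OF that], of "FArr G (e a) \<cdot>\<^bsub>D\<^esub> \<eta> a"] that by auto
  then obtain h where h: "\<And>a. a \<in> Obj C \<Longrightarrow> a \<in> A \<Longrightarrow> h a \<in> Arr D \<and> Dom D (h a) = FObj F a \<and>
      Cod D (h a) = FObj G a \<and> h a \<cdot>\<^bsub>D\<^esub> FArr F (e a) = FArr G (e a) \<cdot>\<^bsub>D\<^esub> \<eta> a"
    by metis
  define \<theta> where "\<theta> = restrict h (Obj C \<inter> A)"
  have \<theta> [simp]: "\<theta> a \<in> Arr D" "Dom D (\<theta> a) = FObj F a" "Cod D (\<theta> a) = FObj G a"
    and \<theta>_e: "\<theta> a \<cdot>\<^bsub>D\<^esub> FArr F (e a) = FArr G (e a) \<cdot>\<^bsub>D\<^esub> \<eta> a" if "a \<in> Obj C" "a \<in> A" for a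
    using h that by (auto simp: \<theta>_def)
  have "nat_trans (full_subcategory C A) D F G \<theta>"
  proof (rule nat_transI[OF F G])
    show "\<theta> \<in> extensional (Obj (full_subcategory C A))"
      by (auto simp: \<theta>_def)
    fix f assume "f \<in> Arr (full_subcategory C A)"
    then have f: "f \<in> Arr C" "Dom C f \<in> A" "Cod C f \<in> A"
      by auto
    let ?a = "Dom C f" and ?b = "Cod C f"
    have nat_F: "FArr F (e ?b) \<cdot>\<^bsub>D\<^esub> FArr F (FArr Q f) = FArr F f \<cdot>\<^bsub>D\<^esub> FArr F (e ?a)"
      using f F.FArr_Comp'[of "FArr Q f" "e ?b"] F.FArr_Comp'[of "e ?a" f]
      by (simp add: counit_natural)
    have nat_G: "FArr G (e ?b) \<cdot>\<^bsub>D\<^esub> FArr G (FArr Q f) = FArr G f \<cdot>\<^bsub>D\<^esub> FArr G (e ?a)"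
      using f G.FArr_Comp'[of "FArr Q f" "e ?b"] G.FArr_Comp'[of "e ?a" f]
      by (simp add: counit_natural)
    have nat_\<eta>: "\<eta> ?b \<cdot>\<^bsub>D\<^esub> FArr F (FArr Q f) = FArr G (FArr Q f) \<cdot>\<^bsub>D\<^esub> \<eta> ?a"
      using f \<eta>.naturality'[of f] by simp
    have "(\<theta> ?b \<cdot>\<^bsub>D\<^esub> FArr F f) \<cdot>\<^bsub>D\<^esub> FArr F (e ?a) =
        (\<theta> ?b \<cdot>\<^bsub>D\<^esub> FArr F (e ?b)) \<cdot>\<^bsub>D\<^esub> FArr F (FArr Q f)"
      using f by (simp add: D_assoc nat_F)
    also have "\<dots> = FArr G (e ?b) \<cdot>\<^bsub>D\<^esub> (FArr G (FArr Q f) \<cdot>\<^bsub>D\<^esub> \<eta> ?a)"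
      using f by (simp add: D_assoc nat_\<eta> \<theta>_e)
    also have "\<dots> = (FArr G f \<cdot>\<^bsub>D\<^esub> FArr G (e ?a)) \<cdot>\<^bsub>D\<^esub> \<eta> ?a"
      using f by (simp flip: D_assoc nat_G)
    also have "\<dots> = (FArr G f \<cdot>\<^bsub>D\<^esub> \<theta> ?a) \<cdot>\<^bsub>D\<^esub> FArr F (e ?a)"
      using f by (simp add: D_assoc \<theta>_e)
    finally have "\<theta> ?b \<cdot>\<^bsub>D\<^esub> FArr F f = FArr G f \<cdot>\<^bsub>D\<^esub> \<theta> ?a"
      by (rule F.target.iso_cancel_right[OF Fe_iso, rotated -1]) (use f in simp_all)
    then show "\<theta> (Cod (full_subcategory C A) f) \<cdot>\<^bsub>D\<^esub> FArr F f =
        FArr G f \<cdot>\<^bsub>D\<^esub> \<theta> (Dom (full_subcategory C A) f)"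
      by simp
  qed auto
  moreover have "\<eta> c = \<theta> (FObj Q c)" if c: "c \<in> Obj C" for c
  proof -
    let ?q = "FObj Q c"
    have "\<eta> c \<cdot>\<^bsub>D\<^esub> FArr F (e ?q) = FArr G (e ?q) \<cdot>\<^bsub>D\<^esub> \<eta> ?q"
      using \<eta>.naturality'[of "e c"] c by (simp add: Q_counit)
    also have "\<dots> = \<theta> ?q \<cdot>\<^bsub>D\<^esub> FArr F (e ?q)"
      using c by (simp add: \<theta>_e)
    finally show ?thesis
      by (rule F.target.iso_cancel_right[OF Fe_iso, rotated -1]) (use c in simp_all)
  qed
  then have "\<eta> = compose (Obj C) \<theta> (FObj Q)"
    using \<eta>.component_extensional by (auto simp: compose_def fun_eq_iff extensional_def)
  ultimately show ?thesis
    by blast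
qed

lemma full_precomposition:
  "full_functor (functor_category (full_subcategory C A) D) (functor_category C D)
    (precomposition C (full_subcategory C A) D Q)"
  unfolding full_functor_def
proof (intro conjI ballI is_functor_precomposition is_functor_axioms)
  let ?P = "precomposition C (full_subcategory C A) D Q"
  fix F G
  assume F: "F \<in> Obj (functor_category (full_subcategory C A) D)"
    and G: "G \<in> Obj (functor_category (full_subcategory C A) D)"
  interpret P: is_functor "functor_category (full_subcategory C A) D" "functor_category C D" ?P
    by (rule is_functor_precomposition[OF is_functor_axioms])
  show "FArr ?P ` hom (functor_category (full_subcategory C A) D) F G =
      hom (functor_category C D) (FObj ?P F) (FObj ?P G)"
  proof (intro equalityI subsetI)
    fix x assume "x \<in> hom (functor_category C D) (FObj ?P F) (FObj ?P G)"
    then obtain \<eta> where x: "x = (functor_comp C F Q, functor_comp C G Q, \<eta>)"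
      and "nat_trans C D (functor_comp C F Q) (functor_comp C G Q) \<eta>"
      using F G by (auto simp: hom_functor_category)
    then obtain \<theta> where "nat_trans (full_subcategory C A) D F G \<theta>"
      "\<eta> = compose (Obj C) \<theta> (FObj Q)"
      using transformation_extends F G by fastforce
    then show "x \<in> FArr ?P ` hom (functor_category (full_subcategory C A) D) F G"
      by (intro image_eqI[of _ _ "(F, G, \<theta>)"]) (auto simp: hom_functor_category x)
  qed (use P.FArr_in_hom in blast)
qed

lemma faithful_precomposition:
  "faithful_functor (functor_category (full_subcategory C A) D) (functor_category C D)
    (precomposition C (full_subcategory C A) D Q)"
  unfolding faithful_functor_def
proof (intro conjI ballI is_functor_precomposition is_functor_axioms inj_onI)
  let ?P = "precomposition C (full_subcategory C A) D Q"
  fix F G x y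
  assume "x \<in> hom (functor_category (full_subcategory C A) D) F G"
    "y \<in> hom (functor_category (full_subcategory C A) D) F G" and eq: "FArr ?P x = FArr ?P y"
  then obtain \<theta> \<zeta> where xy: "x = (F, G, \<theta>)" "y = (F, G, \<zeta>)"
    and nat: "nat_trans (full_subcategory C A) D F G \<theta>" "nat_trans (full_subcategory C A) D F G \<zeta>"
    by (auto simp: hom_functor_category)
  interpret \<theta>: nat_trans "full_subcategory C A" D F G \<theta> by fact
  interpret \<zeta>: nat_trans "full_subcategory C A" D F G \<zeta> by fact
  have "compose (Obj C) \<theta> (FObj Q) = compose (Obj C) \<zeta> (FObj Q)"
    using eq nat by (simp add: xy)
  then have agree: "\<theta> (FObj Q a) = \<zeta> (FObj Q a)" if "a \<in> Obj C" for a
    using that by (metis compose_eq)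
  have "\<theta> a = \<zeta> a" if a: "a \<in> Obj C" "a \<in> A" for a
  proof -
    have iso: "is_iso D (FArr F (e a))"
      using a by (intro \<theta>.source_functor.FArr_iso) (simp add: counit_iso)
    have "\<theta> a \<cdot>\<^bsub>D\<^esub> FArr F (e a) = \<zeta> a \<cdot>\<^bsub>D\<^esub> FArr F (e a)"
      using a nat by (simp add: transformation_determined agree)
    then show ?thesis
      by (rule \<theta>.source_functor.target.iso_cancel_right[OF iso, rotated -1]) (use a in simp_all)
  qed
  then have "\<theta> = \<zeta>"
    using \<theta>.component_extensional \<zeta>.component_extensional
    by (auto intro: extensionalityI)
  then show "x = y"
    by (simp add: xy)
qed

theorem localisation_at_inverted_morphisms:
  "is_localisation TYPE('p) TYPE('n) C \<Sigma> (full_subcategory C A) Q"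
  unfolding is_localisation_def
proof (intro conjI allI ballI impI source.category_axioms target.category_axioms is_functor_axioms
    \<Sigma>_Arr full_precomposition faithful_precomposition)
  fix f assume "f \<in> \<Sigma>"
  then show "is_iso (full_subcategory C A) (FArr Q f)"
    using Q_inverts \<Sigma>_Arr by (auto simp: subset_iff)
next
  fix D :: "('p, 'n) category" and R
  assume "is_functor C D R \<and> (\<forall>f \<in> \<Sigma>. is_iso D (FArr R f))"
  then show "\<exists>R'. is_functor (full_subcategory C A) D R' \<and>
      naturally_isomorphic C D (functor_comp C R' Q) R"
    by (intro functor_extends) auto
qed

end


section \<open>Idempotent subunits\<close>

context monoidal_category
begin

lemma Unit_simp [simp]: "Unit C \<in> Obj C"
  by (rule Unit_in_Obj)

lemma TObj_simp [simp]: "a \<in> Obj C \<Longrightarrow> b \<in> Obj C \<Longrightarrow> a \<otimes>\<^sub>o b \<in> Obj C"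
  by (rule TObj_in_Obj)

lemma TArr_simps [simp]:
  assumes "f \<in> Arr C" "g \<in> Arr C"
  shows "f \<otimes> g \<in> Arr C" "Dom C (f \<otimes> g) = Dom C f \<otimes>\<^sub>o Dom C g"
    "Cod C (f \<otimes> g) = Cod C f \<otimes>\<^sub>o Cod C g"
  using TArr_in_hom[of f "Dom C f" "Cod C f" g "Dom C g" "Cod C g"] assms
  by (auto simp: hom_def)

lemma interchange:
  assumes "f \<in> Arr C" "g \<in> Arr C" "f' \<in> Arr C" "g' \<in> Arr C"
    "Dom C g = Cod C f" "Dom C g' = Cod C f'"
  shows "(g \<otimes> g') \<cdot> (f \<otimes> f') = (g \<cdot> f) \<otimes> (g' \<cdot> f')"
  using TArr_Comp[of f "Dom C f" "Cod C f" g "Cod C g" f' "Dom C f'" "Cod C f'" g' "Cod C g'"] assms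
  by (auto simp: hom_def)

lemma Assoc_simps [simp]:
  assumes "a \<in> Obj C" "b \<in> Obj C" "c \<in> Obj C"
  shows "Assoc C a b c \<in> Arr C" "Dom C (Assoc C a b c) = (a \<otimes>\<^sub>o b) \<otimes>\<^sub>o c"
    "Cod C (Assoc C a b c) = a \<otimes>\<^sub>o (b \<otimes>\<^sub>o c)"
  using Assoc_in_hom[OF assms] by (auto simp: hom_def)

lemma unitor_simps [simp]:
  assumes "a \<in> Obj C"
  shows "LUnit C a \<in> Arr C" "Dom C (LUnit C a) = Unit C \<otimes>\<^sub>o a" "Cod C (LUnit C a) = a"
    "RUnit C a \<in> Arr C" "Dom C (RUnit C a) = a \<otimes>\<^sub>o Unit C" "Cod C (RUnit C a) = a"
  using LUnit_in_hom[OF assms] RUnit_in_hom[OF assms] by (auto simp: hom_def)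

lemma Assoc_natural':
  assumes "f \<in> Arr C" "g \<in> Arr C" "h \<in> Arr C"
  shows "Assoc C (Cod C f) (Cod C g) (Cod C h) \<cdot> ((f \<otimes> g) \<otimes> h) =
    (f \<otimes> (g \<otimes> h)) \<cdot> Assoc C (Dom C f) (Dom C g) (Dom C h)"
  using assms by (intro Assoc_natural) (simp_all add: hom_def)

lemma LUnit_natural': "f \<in> Arr C \<Longrightarrow>
    LUnit C (Cod C f) \<cdot> (Ident C (Unit C) \<otimes> f) = f \<cdot> LUnit C (Dom C f)"
  by (intro LUnit_natural) (simp add: hom_def)

lemma RUnit_natural': "f \<in> Arr C \<Longrightarrow>
    RUnit C (Cod C f) \<cdot> (f \<otimes> Ident C (Unit C)) = f \<cdot> RUnit C (Dom C f)"
  by (intro RUnit_natural) (simp add: hom_def)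

lemma is_iso_TArr:
  assumes f: "is_iso C f" and g: "is_iso C g"
  shows "is_iso C (f \<otimes> g)"
proof -
  obtain f' where f': "f \<in> Arr C" "f' \<in> Arr C" "Dom C f' = Cod C f" "Cod C f' = Dom C f"
      "f' \<cdot> f = Ident C (Dom C f)" "f \<cdot> f' = Ident C (Cod C f)"
    using f by (rule is_isoE)
  obtain g' where g': "g \<in> Arr C" "g' \<in> Arr C" "Dom C g' = Cod C g" "Cod C g' = Dom C g"
      "g' \<cdot> g = Ident C (Dom C g)" "g \<cdot> g' = Ident C (Cod C g)"
    using g by (rule is_isoE)
  show ?thesis
    using f' g' by (intro is_isoI[where g = "f' \<otimes> g'"]) (simp_all add: interchange TArr_Ident)
qed

lemma Unit_TArr_cancel:
  assumes "f \<in> Arr C" "g \<in> Arr C" "Dom C f = Dom C g" "Cod C f = Cod C g"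
    and "Ident C (Unit C) \<otimes> f = Ident C (Unit C) \<otimes> g"
  shows "f = g"
proof -
  have "f \<cdot> LUnit C (Dom C g) = g \<cdot> LUnit C (Dom C g)"
    using assms LUnit_natural'[of f] LUnit_natural'[of g] by simp
  then show ?thesis
    by (rule iso_cancel_right[OF LUnit_iso, rotated -1]) (use assms in simp_all)
qed

lemma TArr_Unit_cancel:
  assumes "f \<in> Arr C" "g \<in> Arr C" "Dom C f = Dom C g" "Cod C f = Cod C g"
    and "f \<otimes> Ident C (Unit C) = g \<otimes> Ident C (Unit C)"
  shows "f = g"
proof -
  have "f \<cdot> RUnit C (Dom C g) = g \<cdot> RUnit C (Dom C g)"
    using assms RUnit_natural'[of f] RUnit_natural'[of g] by simp
  then show ?thesis
    by (rule iso_cancel_right[OF RUnit_iso, rotated -1]) (use assms in simp_all)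
qed

text \<open>
  Kelly's argument: tensoring with the unit on the left is faithful, and after tensoring, the
  pentagon for \<open>I, I, a, b\<close> together with two triangles gives the equation up to composition with
  an isomorphism built from associators.
\<close>

lemma LUnit_TObj:
  assumes [simp]: "a \<in> Obj C" "b \<in> Obj C"
  shows "LUnit C (a \<otimes>\<^sub>o b) \<cdot> Assoc C (Unit C) a b = LUnit C a \<otimes> Ident C b"
proof -
  let ?I = "Unit C" and ?i = "Ident C (Unit C)"
  \<comment> \<open>the two factors of the pentagon that remain once the associator at \<open>I, a, b\<close> is removed\<close>
  let ?p = "Assoc C ?I (?I \<otimes>\<^sub>o a) b \<cdot> (Assoc C ?I ?I a \<otimes> Ident C b)"
  have p_iso: "is_iso C ?p"
    by (intro is_iso_Comp is_iso_TArr Assoc_iso is_iso_Ident) simp_all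
  have split: "?i \<otimes> (LUnit C (a \<otimes>\<^sub>o b) \<cdot> Assoc C ?I a b) =
      (?i \<otimes> LUnit C (a \<otimes>\<^sub>o b)) \<cdot> (?i \<otimes> Assoc C ?I a b)"
    by (simp add: interchange)
  have "(?i \<otimes> (LUnit C (a \<otimes>\<^sub>o b) \<cdot> Assoc C ?I a b)) \<cdot> ?p =
      (?i \<otimes> LUnit C (a \<otimes>\<^sub>o b)) \<cdot>
        (((?i \<otimes> Assoc C ?I a b) \<cdot> Assoc C ?I (?I \<otimes>\<^sub>o a) b) \<cdot> (Assoc C ?I ?I a \<otimes> Ident C b))"
    by (simp add: split assoc)
  also have "\<dots> = (?i \<otimes> LUnit C (a \<otimes>\<^sub>o b)) \<cdot>
      (Assoc C ?I ?I (a \<otimes>\<^sub>o b) \<cdot> Assoc C (?I \<otimes>\<^sub>o ?I) a b)"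
    by (simp add: pentagon)
  also have "\<dots> = ((?i \<otimes> LUnit C (a \<otimes>\<^sub>o b)) \<cdot> Assoc C ?I ?I (a \<otimes>\<^sub>o b)) \<cdot>
      Assoc C (?I \<otimes>\<^sub>o ?I) a b"
    by (simp add: assoc)
  also have "\<dots> = (RUnit C ?I \<otimes> (Ident C a \<otimes> Ident C b)) \<cdot> Assoc C (?I \<otimes>\<^sub>o ?I) a b"
    by (simp add: triangle TArr_Ident)
  also have "\<dots> = Assoc C ?I a b \<cdot> ((RUnit C ?I \<otimes> Ident C a) \<otimes> Ident C b)"
    using Assoc_natural'[of "RUnit C ?I" "Ident C a" "Ident C b"] by simp
  also have "\<dots> = Assoc C ?I a b \<cdot>
      (((?i \<otimes> LUnit C a) \<otimes> Ident C b) \<cdot> (Assoc C ?I ?I a \<otimes> Ident C b))"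
    by (simp add: interchange triangle)
  also have "\<dots> = (?i \<otimes> (LUnit C a \<otimes> Ident C b)) \<cdot> ?p"
    using Assoc_natural'[of ?i "LUnit C a" "Ident C b"] by (simp flip: assoc)
  finally have "?i \<otimes> (LUnit C (a \<otimes>\<^sub>o b) \<cdot> Assoc C ?I a b) = ?i \<otimes> (LUnit C a \<otimes> Ident C b)"
    by (rule iso_cancel_right[OF p_iso, rotated -1]) simp_all
  then show ?thesis
    by (rule Unit_TArr_cancel[rotated -1]) simp_all
qed

text \<open>
  The left unitor at \<open>I \<otimes> I\<close> is the identity of \<open>I\<close> tensored with the left unitor at \<open>I\<close>, so
  \<open>LUnit_TObj\<close> and the triangle identity express both unitors at \<open>I\<close>, tensored with \<open>I\<close> on the
  right, by the same composite. Tensoring with \<open>I\<close> on the right is faithful.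
\<close>

lemma LUnit_Unit: "LUnit C (Unit C) = RUnit C (Unit C)"
proof -
  let ?I = "Unit C" and ?i = "Ident C (Unit C)"
  have "LUnit C ?I \<cdot> LUnit C (?I \<otimes>\<^sub>o ?I) = LUnit C ?I \<cdot> (?i \<otimes> LUnit C ?I)"
    using LUnit_natural'[of "LUnit C ?I"] by simp
  then have "LUnit C (?I \<otimes>\<^sub>o ?I) = ?i \<otimes> LUnit C ?I"
    by (rule iso_cancel_left[OF LUnit_iso, rotated -1]) simp_all
  then have "LUnit C ?I \<otimes> ?i = RUnit C ?I \<otimes> ?i"
    using LUnit_TObj[of ?I ?I] triangle[of ?I ?I] by simp
  then show ?thesis
    by (rule TArr_Unit_cancel[rotated -1]) simp_all
qed

end

locale idempotent_subunit_mono = monoidal_category C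
  for C :: "('o, 'm, 'x) monoidal_category_scheme" (structure) +
  fixes s :: 'm
  assumes mono: "is_mono C s" and Cod_s: "Cod C s = Unit C"
    and idem: "is_iso C (s \<otimes> Ident C (Dom C s))"
begin

abbreviation "S \<equiv> Dom C s"

lemma s_simps [simp]: "s \<in> Arr C" "Cod C s = Unit C"
  using mono Cod_s by (auto simp: is_mono_def)

text \<open>
  The two ways to absorb one factor of \<open>S \<otimes> S\<close> become equal after composing with \<open>s\<close>: by
  naturality of the unitors, both become \<open>s \<otimes> s\<close> followed by a unitor at \<open>I\<close>.
\<close>

lemma absorptions_agree: "LUnit C S \<cdot> (s \<otimes> Ident C S) = RUnit C S \<cdot> (Ident C S \<otimes> s)"
proof -
  let ?i = "Ident C (Unit C)"
  have "s \<cdot> (LUnit C S \<cdot> (s \<otimes> Ident C S)) = (LUnit C (Unit C) \<cdot> (?i \<otimes> s)) \<cdot> (s \<otimes> Ident C S)"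
    using LUnit_natural'[of s] by (simp add: assoc)
  also have "\<dots> = LUnit C (Unit C) \<cdot> (s \<otimes> s)"
    by (simp add: assoc interchange)
  also have "\<dots> = (RUnit C (Unit C) \<cdot> (s \<otimes> ?i)) \<cdot> (Ident C S \<otimes> s)"
    by (simp add: assoc interchange LUnit_Unit)
  also have "\<dots> = s \<cdot> (RUnit C S \<cdot> (Ident C S \<otimes> s))"
    using RUnit_natural'[of s] by (simp add: assoc)
  finally show ?thesis
    using mono unfolding is_mono_def hom_def by (force elim!: ballE[of _ _ "S \<otimes>\<^sub>o S"])
qed

lemma idem_right: "is_iso C (Ident C S \<otimes> s)"
proof (rule is_iso_left_factor[where g = "RUnit C S"])
  show "is_iso C (RUnit C S \<cdot> (Ident C S \<otimes> s))"
    unfolding absorptions_agree[symmetric] by (intro is_iso_Comp idem LUnit_iso) simp_all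
qed (simp_all add: RUnit_iso)

lemma TObj_S_restricts:
  assumes [simp]: "a \<in> Obj C"
  shows "is_iso C (Ident C (a \<otimes>\<^sub>o S) \<otimes> s)"
proof (rule is_iso_left_factor[where g = "Assoc C a S (Unit C)"])
  have "Assoc C a S (Unit C) \<cdot> (Ident C (a \<otimes>\<^sub>o S) \<otimes> s) =
      (Ident C a \<otimes> (Ident C S \<otimes> s)) \<cdot> Assoc C a S S"
    using Assoc_natural'[of "Ident C a" "Ident C S" s] by (simp add: TArr_Ident)
  moreover have "is_iso C \<dots>"
    by (intro is_iso_Comp is_iso_TArr is_iso_Ident idem_right Assoc_iso) simp_all
  ultimately show "is_iso C (Assoc C a S (Unit C) \<cdot> (Ident C (a \<otimes>\<^sub>o S) \<otimes> s))"
    by simp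
qed (simp_all add: Assoc_iso)

lemma restriction_inverts:
  assumes [simp]: "a \<in> Obj C"
  shows "is_iso C ((Ident C a \<otimes> s) \<otimes> Ident C S)"
proof (rule is_iso_left_factor[where g = "Assoc C a (Unit C) S"])
  have "Assoc C a (Unit C) S \<cdot> ((Ident C a \<otimes> s) \<otimes> Ident C S) =
      (Ident C a \<otimes> (s \<otimes> Ident C S)) \<cdot> Assoc C a S S"
    using Assoc_natural'[of "Ident C a" s "Ident C S"] by simp
  moreover have "is_iso C \<dots>"
    by (intro is_iso_Comp is_iso_TArr is_iso_Ident idem Assoc_iso) simp_all
  ultimately show "is_iso C (Assoc C a (Unit C) S \<cdot> ((Ident C a \<otimes> s) \<otimes> Ident C S))"
    by simp
qed (simp_all add: Assoc_iso)

lemma is_functor_restriction: "is_functor C (restriction C s) (restriction_functor C s)"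
proof -
  interpret L: category "restriction C s"
    unfolding restriction_def by (rule category_full_subcategory) unfold_locales
  show ?thesis
    by unfold_locales
      (auto simp: restriction_functor_def restriction_def hom_def TObj_S_restricts TArr_Ident
        interchange)
qed

definition restriction_counit :: "'o \<Rightarrow> 'm" where
  "restriction_counit a = RUnit C a \<cdot> (Ident C a \<otimes> s)"

lemma restriction_counit_natural:
  assumes [simp]: "f \<in> Arr C"
  shows "restriction_counit (Cod C f) \<cdot> (f \<otimes> Ident C S) = f \<cdot> restriction_counit (Dom C f)"
proof -
  have "restriction_counit (Cod C f) \<cdot> (f \<otimes> Ident C S) =
      (RUnit C (Cod C f) \<cdot> (f \<otimes> Ident C (Unit C))) \<cdot> (Ident C (Dom C f) \<otimes> s)"
    by (simp add: restriction_counit_def assoc interchange)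
  also have "\<dots> = f \<cdot> restriction_counit (Dom C f)"
    using RUnit_natural'[of f] by (simp add: restriction_counit_def assoc)
  finally show ?thesis .
qed

lemma inverting_coreflection_restriction:
  "inverting_coreflection C {a \<in> Obj C. is_iso C (Ident C a \<otimes> s)} (restriction_functor C s)
    restriction_counit {Ident C a \<otimes> s | a. a \<in> Obj C}"
proof (intro inverting_coreflection.intro inverting_coreflection_axioms.intro)
  show "is_functor C (full_subcategory C {a \<in> Obj C. is_iso C (Ident C a \<otimes> s)})
      (restriction_functor C s)"
    using is_functor_restriction by (simp add: restriction_def)
next
  fix a assume a: "a \<in> Obj C"
  then show "restriction_counit a \<in> hom C (FObj (restriction_functor C s) a) a"
    by (simp add: restriction_counit_def restriction_functor_def hom_def)
  show "\<exists>f \<in> {Ident C a \<otimes> s | a. a \<in> Obj C}. \<exists>g. is_iso C g \<and> Dom C g = Cod C f \<and>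
      restriction_counit a = g \<cdot> f"
    using a by (intro bexI[of _ "Ident C a \<otimes> s"] exI[of _ "RUnit C a"])
      (auto simp: restriction_counit_def RUnit_iso)
  assume "a \<in> {a \<in> Obj C. is_iso C (Ident C a \<otimes> s)}"
  then show "is_iso C (restriction_counit a)"
    by (auto simp: restriction_counit_def intro!: is_iso_Comp RUnit_iso)
next
  fix f assume "f \<in> Arr C"
  then show "restriction_counit (Cod C f) \<cdot> FArr (restriction_functor C s) f =
      f \<cdot> restriction_counit (Dom C f)"
    by (simp add: restriction_functor_def restriction_counit_natural)
next
  show "{Ident C a \<otimes> s | a. a \<in> Obj C} \<subseteq> Arr C"
    by auto
next
  fix f assume "f \<in> {Ident C a \<otimes> s | a. a \<in> Obj C}"
  then show "is_iso C (FArr (restriction_functor C s) f)"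
    by (auto simp: restriction_functor_def restriction_inverts)
qed

end

theorem proposition17:
  fixes C :: "('o, 'm, 'x) monoidal_category_scheme"
    and \<sigma> :: "'m set" and s :: 'm
  assumes "monoidal_category C"
    and "\<sigma> \<in> subunits C" and "s \<in> \<sigma>" and "idempotent_subunit C s"
  shows "is_localisation TYPE('p) TYPE('n) C {Ident C a \<otimes>\<^bsub>C\<^esub> s | a. a \<in> Obj C}
    (restriction C s) (restriction_functor C s)"
proof -
  have s: "is_mono C s" "Cod C s = Unit C"
    using assms(2,3)
    by (auto simp: subunits_def subobjects_def quotient_def mono_equiv_def monos_into_def)
  interpret idempotent_subunit_mono C s
    using assms(1,4) s
    by (simp add: idempotent_subunit_mono_def idempotent_subunit_mono_axioms_def
        idempotent_subunit_def)
  show ?thesis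
    unfolding restriction_def
    by (rule inverting_coreflection.localisation_at_inverted_morphisms[OF inverting_coreflection_restriction])
qed

end
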